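(* Let $G$ be a finite group and $H$ a non-trivial proper normal subgroup of $G$. Then for any even integer $k$ between $2$ and $|H|$ (inclusive), $H$ is a $(0,k)$-regular set of $G$.
   Context: All groups are finite. $e$ is the identity of $G$. For an inverse-closed subset $S$ of $G\setminus\{e\}$ (i.e. $S^{-1}=S$), $\mathrm{Cay}(G,S)$ is the graph with vertex set $G$ and edge set $\{\{x,y\}: x,y\in G,\ yx^{-1}\in S\}$. A $(0,k)$-regular set in a graph $\Gamma$ is a nonempty proper subset $D$ of $V(\Gamma)$ such that every vertex in $D$ has no neighbour in $D$ and every vertex in $V(\Gamma)\setminus D$ has exactly $k$ neighbours in $D$. A subset $D$ of a group $G$ is a $(0,k)$-regular set of $G$ if it is a $(0,k)$-regular set in $\mathrm{Cay}(G,S)$ for some inverse-closed $S\subseteq G\setminus\{e\}$. *)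

theory Defs
  imports "HOL-Algebra.Algebra"
begin

text \<open>
  An undirected graph is given by its vertex set and a set of edges, each edge being an
  unordered pair of vertices.
\<close>

type_synonym 'a ugraph = "'a set \<times> 'a set set"

abbreviation gverts :: "'a ugraph \<Rightarrow> 'a set" where
  "gverts \<Gamma> \<equiv> fst \<Gamma>"

abbreviation gedges :: "'a ugraph \<Rightarrow> 'a set set" where
  "gedges \<Gamma> \<equiv> snd \<Gamma>"

definition neighbours_in :: "'a ugraph \<Rightarrow> 'a set \<Rightarrow> 'a \<Rightarrow> 'a set" where
  "neighbours_in \<Gamma> D v = {w \<in> D. {v, w} \<in> gedges \<Gamma>}"

text \<open>
  Graphs are meant to be finite here: the neighbours of a vertex are counted with \<^const>\<open>card\<close>,
  which is 0 on infinite sets.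
\<close>

definition zero_regular_set_in :: "nat \<Rightarrow> 'a ugraph \<Rightarrow> 'a set \<Rightarrow> bool" where
  "zero_regular_set_in k \<Gamma> D \<longleftrightarrow>
     D \<noteq> {} \<and> D \<subset> gverts \<Gamma> \<and>
     (\<forall>v \<in> D. neighbours_in \<Gamma> D v = {}) \<and>
     (\<forall>v \<in> gverts \<Gamma> - D. card (neighbours_in \<Gamma> D v) = k)"

definition connection_set :: "('a, 'b) monoid_scheme \<Rightarrow> 'a set \<Rightarrow> bool" where
  "connection_set G S \<longleftrightarrow> S \<subseteq> carrier G - {\<one>\<^bsub>G\<^esub>} \<and> set_inv\<^bsub>G\<^esub> S = S"

definition Cay :: "('a, 'b) monoid_scheme \<Rightarrow> 'a set \<Rightarrow> 'a ugraph" where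
  "Cay G S = (carrier G,
     {{x, y} | x y. x \<in> carrier G \<and> y \<in> carrier G \<and> y \<otimes>\<^bsub>G\<^esub> inv\<^bsub>G\<^esub> x \<in> S})"

definition zero_regular_set :: "nat \<Rightarrow> ('a, 'b) monoid_scheme \<Rightarrow> 'a set \<Rightarrow> bool" where
  "zero_regular_set k G D \<longleftrightarrow>
     (\<exists>S. connection_set G S \<and> zero_regular_set_in k (Cay G S) D)"

end

theory Submission
  imports Defs
begin

text \<open>
  A suitable connection set avoids \<open>H\<close> and meets every other coset of \<open>H\<close> in exactly \<open>k\<close>
  elements. Inversion permutes the cosets: on a pair \<open>C \<noteq> C\<^sup>-\<^sup>1\<close> take any \<open>k\<close> elements of \<open>C\<close>
  together with their inverses; a coset \<open>C = C\<^sup>-\<^sup>1\<close> splits into pairs \<open>{x, x\<^sup>-\<^sup>1}\<close> and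
  involutions, out of which an inverse-closed subset of any even size up to \<open>|C|\<close> can be built.
\<close>

text \<open>Induction on half the size: an invariant set that leaves at least two elements of
  \<open>C\<close> uncovered can be enlarged by exactly two. Steps of size two are forced when
  \<open>f\<close> has no fixed points.\<close>

lemma ex_invariant_subset_card:
  assumes "finite C" and "\<And>x. x \<in> C \<Longrightarrow> f x \<in> C" and inv: "\<And>x. x \<in> C \<Longrightarrow> f (f x) = x"
    and "even k" and "k \<le> card C"
  shows "\<exists>T \<subseteq> C. f ` T = T \<and> card T = k"
proof -
  have "2 * n \<le> card C \<Longrightarrow> \<exists>T \<subseteq> C. f ` T = T \<and> card T = 2 * n" for n
  proof (induction n)
    case 0
    show ?case by (intro exI[of _ "{}"]) auto
  next
    case (Suc n)
    then obtain T where T: "T \<subseteq> C" "f ` T = T" "card T = 2 * n" by auto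
    then have fin: "finite T" using \<open>finite C\<close> finite_subset by blast
    have "card (C - T) \<ge> 2"
      using Suc.prems T fin by (simp add: card_Diff_subset)
    then obtain a b where ab: "a \<in> C - T" "b \<in> C - T" "a \<noteq> b"
      by (meson card_2_iff' obtain_subset_with_card_n subsetD)
    \<comment> \<open>Two fixed points form an invariant pair; otherwise \<open>a\<close> or
      \<open>b\<close> is moved and is paired with its image, which lies outside \<open>T\<close>
      because \<open>T\<close> is invariant under the involution.\<close>
    have "\<exists>x y. x \<in> C - T \<and> y \<in> C - T \<and> x \<noteq> y \<and> f ` {x, y} = {x, y}"
    proof (cases "f a = a \<and> f b = b")
      case True
      with ab show ?thesis by (intro exI[of _ a] exI[of _ b]) auto
    next
      case False
      then obtain x where x: "x \<in> C - T" "f x \<noteq> x" using ab by blast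
      then have "f x \<in> C" "f (f x) = x" using assms(2) inv by auto
      moreover from this have "f x \<notin> T" using x T(2) by (metis DiffD2 imageI)
      ultimately show ?thesis using x by (intro exI[of _ x] exI[of _ "f x"]) auto
    qed
    then obtain x y where xy: "x \<in> C - T" "y \<in> C - T" "x \<noteq> y" "f ` {x, y} = {x, y}"
      by blast
    have "f ` (T \<union> {x, y}) = T \<union> {x, y}" using T(2) xy(4) by (simp only: image_Un)
    moreover have "card (T \<union> {x, y}) = 2 * Suc n" using T fin xy by simp
    ultimately show ?case using T xy by (intro exI[of _ "T \<union> {x, y}"]) auto
  qed
  from this[of "k div 2"] assms show ?thesis by simp
qed

text \<open>Group-free core of the construction, to be applied with \<open>f\<close> as inversion
  and \<open>P\<close> as the right cosets other than \<open>H\<close>.\<close>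

lemma ex_invariant_transversal_card:
  assumes disj: "\<And>C D. C \<in> P \<Longrightarrow> D \<in> P \<Longrightarrow> C \<noteq> D \<Longrightarrow> C \<inter> D = {}"
    and perm: "\<And>C. C \<in> P \<Longrightarrow> f ` C \<in> P"
    and inv: "\<And>C x. C \<in> P \<Longrightarrow> x \<in> C \<Longrightarrow> f (f x) = x"
    and fin: "\<And>C. C \<in> P \<Longrightarrow> finite C"
    and "even k" and le: "\<And>C. C \<in> P \<Longrightarrow> k \<le> card C"
  shows "\<exists>S \<subseteq> \<Union>P. f ` S = S \<and> (\<forall>C \<in> P. card (S \<inter> C) = k)"
proof -
  \<comment> \<open>Choosing one set per unordered pair \<open>{C, f ` C}\<close> makes the choices for \<open>C\<close> and \<open>f ` C\<close> agree.\<close>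
  define good where "good U T \<longleftrightarrow> T \<subseteq> \<Union>U \<and> f ` T = T \<and> (\<forall>C \<in> U. card (T \<inter> C) = k)" for U T
  define g where "g U = (SOME T. good U T)" for U
  have ff: "f ` f ` C = C" if "C \<in> P" for C
  proof -
    have "(\<lambda>x. f (f x)) ` C = (\<lambda>x. x) ` C" using inv[OF that] by (rule image_cong[OF refl])
    then show ?thesis by (simp add: image_image)
  qed
  have good: "good {C, f ` C} (g {C, f ` C})" if C: "C \<in> P" for C
  proof -
    have "\<exists>T. good {C, f ` C} T"
    proof (cases "f ` C = C")
      case True
      then have "f x \<in> C" if "x \<in> C" for x using that by blast
      from ex_invariant_subset_card[OF fin[OF C] this inv[OF C] \<open>even k\<close> le[OF C]]
      obtain T where "T \<subseteq> C" "f ` T = T" "card T = k" by blast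
      then have "good {C, f ` C} T" unfolding good_def True by (simp add: Int_absorb2)
      then show ?thesis ..
    next
      case False
      then have d: "C \<inter> f ` C = {}" using disj[of C "f ` C"] perm C by auto
      obtain A where A: "A \<subseteq> C" "card A = k"
        using obtain_subset_with_card_n[OF le[OF C]] by blast
      have "(\<lambda>x. f (f x)) ` A = (\<lambda>x. x) ` A"
        using A inv[OF C] by (intro image_cong) auto
      then have "f ` f ` A = A" by (simp add: image_image)
      moreover have "card (f ` A) = k"
        using A inv[OF C] by (metis card_image inj_on_inverseI subsetD)
      moreover have "(A \<union> f ` A) \<inter> C = A" "(A \<union> f ` A) \<inter> f ` C = f ` A" using A d by auto
      ultimately show ?thesis using A
        by (intro exI[of _ "A \<union> f ` A"]) (auto simp: good_def image_Un Un_commute)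
    qed
    then show ?thesis unfolding g_def by (rule someI_ex)
  qed
  define S where "S = (\<Union>C \<in> P. g {C, f ` C})"
  have "S \<subseteq> \<Union>P" using good perm unfolding S_def good_def by blast
  moreover have "f ` S = S"
    unfolding S_def image_UN using good by (intro SUP_cong) (auto simp: good_def)
  moreover have "card (S \<inter> C) = k" if C: "C \<in> P" for C
  proof -
    \<comment> \<open>Only the piece chosen for the pair containing \<open>C\<close> can meet
      \<open>C\<close>: every other piece lies in blocks disjoint from \<open>C\<close>.\<close>
    have "g {D, f ` D} \<inter> C \<subseteq> g {C, f ` C}" if D: "D \<in> P" for D
    proof (cases "D = C \<or> f ` D = C")
      case True
      then have "{D, f ` D} = {C, f ` C}" using ff[OF D] by auto
      then show ?thesis by simp
    next
      case False
      then have "D \<inter> C = {}" "f ` D \<inter> C = {}" using disj perm C D by auto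
      then show ?thesis using good[OF D] unfolding good_def by blast
    qed
    then have "S \<inter> C = g {C, f ` C} \<inter> C" using C unfolding S_def by blast
    then show ?thesis using good[OF C] by (simp add: good_def)
  qed
  ultimately show ?thesis by (intro exI[of _ S]) simp
qed

text \<open>An unordered edge may be read in either direction, giving a quotient or its inverse;
  closure of \<open>S\<close> under inversion makes the two conditions equivalent.\<close>

lemma (in group) neighbours_in_Cay:
  assumes S: "connection_set G S" and D: "D \<subseteq> carrier G" and v: "v \<in> carrier G"
  shows "neighbours_in (Cay G S) D v = {w \<in> D. w \<otimes> inv v \<in> S}"
proof -
  have "w \<otimes> inv v \<in> S" if "v \<otimes> inv w \<in> S" "w \<in> carrier G" for w
  proof -
    have "inv (v \<otimes> inv w) \<in> set_inv S" using that(1) unfolding SET_INV_def by blast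
    then show ?thesis using S v that(2) by (simp add: connection_set_def inv_mult_group)
  qed
  then show ?thesis
    using D v by (fastforce simp: neighbours_in_def Cay_def doubleton_eq_iff)
qed

text \<open>Right translation by \<open>inv v\<close> is injective. For a subgroup \<open>D\<close>
  this turns neighbour counts into intersections of \<open>S\<close> with right cosets.\<close>

lemma (in group) card_neighbours_in_Cay:
  assumes S: "connection_set G S" and D: "D \<subseteq> carrier G" and v: "v \<in> carrier G"
  shows "card (neighbours_in (Cay G S) D v) = card (S \<inter> (D #> inv v))"
proof -
  have "S \<inter> (D #> inv v) = (\<lambda>w. w \<otimes> inv v) ` {w \<in> D. w \<otimes> inv v \<in> S}"
    unfolding r_coset_def by blast
  moreover have "inj_on (\<lambda>w. w \<otimes> inv v) {w \<in> D. w \<otimes> inv v \<in> S}"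
    using D v by (intro inj_onI) (auto simp: subset_iff)
  ultimately show ?thesis by (simp add: neighbours_in_Cay[OF assms] card_image)
qed

lemma (in normal) zero_regular_set_normal:
  assumes "finite (carrier G)" and "H \<noteq> carrier G" and "even k" and "k \<le> card H"
  shows "zero_regular_set k G H"
proof -
  have subG: "subgroup H G" ..
  define P where "P = rcosets H - {H}"
  have set_inv: "set_inv C = (\<lambda>x. inv x) ` C" for C
    unfolding SET_INV_def by blast
  have carr: "C \<subseteq> carrier G" if "C \<in> P" for C
    using that rcosets_part_G[OF subG] unfolding P_def by blast
  have disj: "C \<inter> D = {}" if "C \<in> rcosets H" "D \<in> rcosets H" "C \<noteq> D" for C D
    using rcos_disjoint[OF subG] that by (auto simp: pairwise_def disjnt_def)
  have H_rcos: "H \<in> rcosets H" by (rule subgroup_in_rcosets[OF is_group])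
  have "\<exists>S \<subseteq> \<Union>P. (\<lambda>x. inv x) ` S = S \<and> (\<forall>C \<in> P. card (S \<inter> C) = k)"
  proof (rule ex_invariant_transversal_card)
    fix C assume C: "C \<in> P"
    then obtain x where x: "x \<in> carrier G" "C = H #> x" "C \<noteq> H"
      unfolding P_def RCOSETS_def by blast
    have "H #> inv x \<noteq> H"
    proof
      assume "H #> inv x = H"
      then have "inv x \<in> H" using rcos_self[OF inv_closed[OF x(1)] subG] by simp
      then have "x \<in> H" using m_inv_closed x(1) by fastforce
      then show False using x rcos_const by simp
    qed
    \<comment> \<open>Normality enters here through \<open>rcos_inv\<close>: the inverses of the
      elements of \<open>H #> x\<close> form the right coset \<open>H #> inv x\<close>.\<close>
    then show "(\<lambda>x. inv x) ` C \<in> P"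
      using x rcos_inv[of x] by (auto simp: set_inv[symmetric] P_def RCOSETS_def)
    show "finite C" using carr[OF C] assms(1) finite_subset by blast
    show "k \<le> card C"
      using C card_rcosets_equal[of C H] subset assms(4) unfolding P_def by simp
    show "inv (inv y) = y" if "y \<in> C" for y using that carr[OF C] by auto
  qed (use disj \<open>even k\<close> in \<open>auto simp: P_def\<close>)
  then obtain S where S: "S \<subseteq> \<Union>P" "(\<lambda>x. inv x) ` S = S" "\<And>C. C \<in> P \<Longrightarrow> card (S \<inter> C) = k"
    by blast
  have SH: "S \<inter> H = {}" using S(1) disj[OF _ H_rcos] unfolding P_def by blast
  then have "\<one> \<notin> S" using subgroup.one_closed[OF subG] by blast
  moreover have "S \<subseteq> carrier G" using S(1) carr by blast
  ultimately have conn: "connection_set G S"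
    using S(2) unfolding connection_set_def set_inv by (simp add: subset_Diff_insert)
  \<comment> \<open>For \<open>v\<close> and \<open>w\<close> in \<open>H\<close> the quotient
    \<open>w \<otimes> inv v\<close> stays in \<open>H\<close>, which \<open>S\<close>
    avoids.\<close>
  have "neighbours_in (Cay G S) H v = {}" if "v \<in> H" for v
    using SH that subset by (auto simp: neighbours_in_Cay[OF conn subset])
  moreover have "card (neighbours_in (Cay G S) H v) = k" if v: "v \<in> carrier G" "v \<notin> H" for v
  proof -
    have "H #> inv v \<noteq> H"
    proof
      assume "H #> inv v = H"
      then have "inv v \<in> H" using rcos_self[OF inv_closed[OF v(1)] subG] by simp
      then show False using m_inv_closed v by fastforce
    qed
    then have "H #> inv v \<in> P" using v unfolding P_def RCOSETS_def by blast
    then show ?thesis using S(3) card_neighbours_in_Cay[OF conn subset v(1)] by simp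
  qed
  moreover have "H \<noteq> {}" using subgroup.one_closed[OF subG] by blast
  ultimately have "zero_regular_set_in k (Cay G S) H"
    using subset assms(2) by (simp add: zero_regular_set_in_def psubset_eq) (simp add: Cay_def)
  then show ?thesis using conn unfolding zero_regular_set_def by blast
qed

theorem theorem4p1:
  fixes G :: "('a, 'b) monoid_scheme" and H :: "'a set" and k :: nat
  assumes "group G" and "finite (carrier G)"
    and "H \<lhd> G" and "H \<noteq> {\<one>\<^bsub>G\<^esub>}" and "H \<noteq> carrier G"
    and "even k" and "2 \<le> k" and "k \<le> card H"
  shows "zero_regular_set k G H"
  by (rule normal.zero_regular_set_normal) fact+

end
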